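(* The function $\theta(x)=\sqrt[x]{2\,\zeta(x)\,\Gamma(x+1)}=\bigl(2\zeta(x)\Gamma(x+1)\bigr)^{1/x}$ is log-concave on $(7.1,\infty)$.
   Context: Here $\zeta(x)=\sum_{n\geq 1} n^{-x}$ is the Riemann zeta function (real $x>1$) and $\Gamma$ is the Euler Gamma function. A positive function is log-concave on an interval if its logarithm is concave there. *)

theory Defs
  imports "HOL-Analysis.Analysis"
begin

text \<open>The series is indexed from 0, so its \<open>n\<close>-th term is \<open>(n + 1)\<close> to the power \<open>- x\<close>; for
  \<open>x \<le> 1\<close> it diverges and the value is unspecified.\<close>
definition zeta :: "real \<Rightarrow> real" where
  "zeta x = (\<Sum>n. real (Suc n) powr (- x))"

definition theta :: "real \<Rightarrow> real" where
  "theta x = (2 * zeta x * Gamma (x + 1)) powr (1 / x)"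

text \<open>Positivity is part of the notion, since \<^const>\<open>ln\<close> is only meaningful on positive arguments.\<close>
definition log_concave_on :: "real set \<Rightarrow> (real \<Rightarrow> real) \<Rightarrow> bool" where
  "log_concave_on S f \<longleftrightarrow> (\<forall>x\<in>S. f x > 0) \<and> concave_on S (\<lambda>x. ln (f x))"

end

theory Submission
  imports Defs "HOL-Real_Asymp.Real_Asymp"
begin

text \<open>
  Writing \<open>L x = ln 2 + ln (zeta x) + ln (Gamma (x + 1))\<close>, the second derivative of
  \<open>ln (theta x) = L x / x\<close> is \<open>(x\<^sup>2 L'' - 2 x L' + 2 L) / x\<^sup>3\<close>. The Gamma part of
  the numerator has derivative \<open>x\<^sup>2 Polygamma 2 (x + 1) < 0\<close>, so on \<open>[7, \<infinity>)\<close> it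
  is at most its value at 7, which together with \<open>2 ln 2\<close> is below -5/2. Since \<open>zeta x \<ge> 1\<close>,
  the zeta part is at most the sum over \<open>n \<ge> 2\<close> of \<open>exp (- u) (u\<^sup>2 + 2 u + 2)\<close> with
  \<open>u = x ln n\<close>, which is dominated by a multiple of the sum of \<open>n\<close> to the power -3.
\<close>

section \<open>Termwise derivatives of the zeta series\<close>

definition zeta_deriv :: "nat \<Rightarrow> real \<Rightarrow> real" where
  "zeta_deriv k x = (\<Sum>n. (- ln (real (Suc n))) ^ k * real (Suc n) powr (- x))"

lemma zeta_deriv_0: "zeta_deriv 0 = zeta"
  by (simp add: fun_eq_iff zeta_deriv_def zeta_def)

lemma summable_ln_power_powr:
  assumes "x > 1"
  shows "summable (\<lambda>n. ln (real (Suc n)) ^ k * real (Suc n) powr (- x))"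
proof -
  \<comment> \<open>Half the distance from \<open>x\<close> to 1: a power of the logarithm is
    O(\<open>n powr e\<close>), and the remaining exponent -(x + 1)/2 is still below -1.\<close>
  define e where "e = (x - 1) / 2"
  have e: "e > 0" "- x + e < - 1"
    using assms by (auto simp: e_def field_simps)
  have "(\<lambda>n. ln (real n) ^ k * real n powr (- x)) \<in> O(\<lambda>n. real n powr (- x + e))"
  proof -
    have "(\<lambda>n. ln (real n) ^ k) \<in> O(\<lambda>n. real n powr e)"
      using e(1) by real_asymp
    then have "(\<lambda>n. ln (real n) ^ k * real n powr (- x)) \<in> O(\<lambda>n. real n powr e * real n powr (- x))"
      by (rule landau_o.big.mult_right)
    then show ?thesis
      by (simp only: powr_add mult.commute)
  qed
  moreover have "summable (\<lambda>n. norm (real n powr (- x + e)))"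
    using e(2) by (simp add: summable_real_powr_iff)
  ultimately have "summable (\<lambda>n. ln (real n) ^ k * real n powr (- x))"
    by (rule summable_comparison_test_bigo[rotated])
  then show ?thesis
    by (subst summable_Suc_iff)
qed

lemma summable_zeta_deriv:
  assumes "x > 1"
  shows "summable (\<lambda>n. (- ln (real (Suc n))) ^ k * real (Suc n) powr (- x))"
proof -
  have "(\<lambda>n. (- ln (real (Suc n))) ^ k * real (Suc n) powr (- x)) =
      (\<lambda>n. (- 1) ^ k * (ln (real (Suc n)) ^ k * real (Suc n) powr (- x)))"
    by (simp add: fun_eq_iff power_minus[of "ln _"])
  then show ?thesis
    using summable_mult[OF summable_ln_power_powr[OF assms, of k], of "(- 1) ^ k"] by simp
qed

lemma has_field_derivative_zeta_deriv:
  assumes "x > 1"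
  shows "(zeta_deriv k has_field_derivative zeta_deriv (Suc k) x) (at x)"
proof -
  \<comment> \<open>Any point strictly between 1 and \<open>x\<close> would do: to the right of
    \<open>s\<close> every term is dominated by its value at \<open>s\<close>, so the M-test gives
    uniform convergence of the differentiated series near \<open>x\<close>.\<close>
  define s where "s = (1 + x) / 2"
  have s: "s > 1" "s < x"
    using assms by (auto simp: s_def)
  have "((\<lambda>x. \<Sum>n. (- ln (real (Suc n))) ^ k * real (Suc n) powr (- x)) has_field_derivative
      (\<Sum>n. (- ln (real (Suc n))) ^ Suc k * real (Suc n) powr (- x))) (at x)"
  proof (rule has_field_derivative_series'(2))
    show "convex {s<..}"
      by simp
    show "((\<lambda>x. (- ln (real (Suc n))) ^ k * real (Suc n) powr (- x)) has_field_derivative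
        (- ln (real (Suc n))) ^ Suc k * real (Suc n) powr (- y)) (at y within {s<..})" for n y
      unfolding powr_def by (auto intro!: derivative_eq_intros)
    show "uniformly_convergent_on {s<..}
        (\<lambda>n x. \<Sum>i<n. (- ln (real (Suc i))) ^ Suc k * real (Suc i) powr (- x))"
    proof (rule Weierstrass_m_test')
      show "summable (\<lambda>n. ln (real (Suc n)) ^ Suc k * real (Suc n) powr (- s))"
        by (rule summable_ln_power_powr[OF s(1)])
      fix n y assume "y \<in> {s<..}"
      then have "real (Suc n) powr (- y) \<le> real (Suc n) powr (- s)"
        by (intro powr_mono) auto
      then show "norm ((- ln (real (Suc n))) ^ Suc k * real (Suc n) powr (- y))
          \<le> ln (real (Suc n)) ^ Suc k * real (Suc n) powr (- s)"
        by (auto simp: abs_mult power_abs simp del: power_Suc intro!: mult_left_mono)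
    qed
    show "x \<in> {s<..}" "x \<in> interior {s<..}"
      using s by (auto simp: interior_open)
    show "summable (\<lambda>n. (- ln (real (Suc n))) ^ k * real (Suc n) powr (- x))"
      by (rule summable_zeta_deriv[OF assms])
  qed
  then show ?thesis
    by (simp only: zeta_deriv_def[abs_def])
qed

lemma zeta_ge_1:
  assumes "x > 1"
  shows "zeta x \<ge> 1"
proof -
  have "(\<Sum>n\<in>{0}. real (Suc n) powr (- x)) \<le> zeta x"
    unfolding zeta_def using summable_zeta_deriv[OF assms, of 0]
    by (intro sum_le_suminf) auto
  then show ?thesis
    by simp
qed

section \<open>Upper bound for the zeta part of the numerator\<close>

lemma sums_inverse_three_consecutive:
  "(\<lambda>n. 1 / (real (n + 1) * real (n + 2) * real (n + 3))) sums (1 / 4)"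
proof -
  define f where "f n = 1 / (2 * real (n + 1) * real (n + 2))" for n
  have "f \<longlonglongrightarrow> 0"
    unfolding f_def by real_asymp
  from telescope_sums'[OF this] have "(\<lambda>n. f n - f (Suc n)) sums (1 / 4)"
    by (simp add: f_def)
  moreover have "f n - f (Suc n) = 1 / (real (n + 1) * real (n + 2) * real (n + 3))" for n
    unfolding f_def by (simp add: divide_simps) (simp add: algebra_simps)
  ultimately show ?thesis
    by simp
qed

lemma zeta_term_bound:
  assumes "x \<ge> 7"
  shows "(x\<^sup>2 * (ln (real (n + 2)))\<^sup>2 + 2 * x * ln (real (n + 2)) + 2) * real (n + 2) powr (- x)
    \<le> 49 / 8 * (1 / (real (n + 1) * real (n + 2) * real (n + 3)))"
proof -
  define m where "m = real (n + 2)"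
  define u where "u = x * ln m"
  have m: "m \<ge> 2"
    by (simp add: m_def)
  have u: "u \<ge> 7 * ln m" "u \<ge> 0"
    using m assms by (auto simp: u_def intro!: mult_right_mono)
  \<comment> \<open>The rate 4/7 leaves exp(-3u/7), which is at most m^(-3) because u \<ge> 7 ln m.
    Multiplying by 49/8 makes the coefficient of u^2 equal to 1, and the other two become 7/2 \<ge>
    2 and 49/8 \<ge> 2.\<close>
  have "1 + (4 / 7 * u) + (4 / 7 * u)\<^sup>2 / 2 \<le> exp (4 / 7 * u)"
    using u by (intro exp_lower_Taylor_quadratic) auto
  then have "u\<^sup>2 + 2 * u + 2 \<le> 49 / 8 * exp (4 / 7 * u)"
    using u by (simp add: power2_eq_square)
  then have "(u\<^sup>2 + 2 * u + 2) * exp (- u) \<le> 49 / 8 * exp (4 / 7 * u) * exp (- u)"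
    by (intro mult_right_mono) auto
  also have "\<dots> = 49 / 8 * exp (- (3 / 7 * u))"
    by (simp flip: exp_add)
  also have "exp (- (3 / 7 * u)) \<le> exp (- (3 * ln m))"
    using u by simp
  also have "exp (- (3 * ln m)) = 1 / m ^ 3"
    using m exp_of_nat_mult[of 3 "ln m"] by (simp add: exp_minus field_simps)
  \<comment> \<open>Replacing m^3 by m^3 - m gives a majorant whose sum telescopes.\<close>
  also have "1 / m ^ 3 \<le> 1 / ((m - 1) * m * (m + 1))"
    using m by (intro divide_left_mono mult_pos_pos) (auto simp: power3_eq_cube algebra_simps)
  finally have *: "(u\<^sup>2 + 2 * u + 2) * exp (- u) \<le> 49 / 8 * (1 / ((m - 1) * m * (m + 1)))"
    by simp
  have "exp (- u) = m powr (- x)"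
    using m by (simp add: powr_def u_def)
  with * show ?thesis
    by (simp add: u_def m_def power_mult_distrib algebra_simps)
qed

lemma zeta_part_bound:
  assumes "x \<ge> 7"
  shows "x\<^sup>2 * zeta_deriv 2 x - 2 * x * zeta_deriv 1 x + 2 * (zeta x - 1) \<le> 49 / 32"
proof -
  have x: "x > 1"
    using assms by simp
  define t where "t k n = (- ln (real (Suc n))) ^ k * real (Suc n) powr (- x)" for k n
  have t: "t k sums zeta_deriv k x" for k
    using summable_zeta_deriv[OF x, of k] unfolding t_def[abs_def] zeta_deriv_def
    by (rule summable_sums)
  let ?f = "\<lambda>n. x\<^sup>2 * t 2 n - 2 * x * t 1 n + 2 * t 0 n"
  have "?f sums (x\<^sup>2 * zeta_deriv 2 x - 2 * x * zeta_deriv 1 x + 2 * zeta_deriv 0 x)"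
    by (intro sums_add sums_diff sums_mult t)
  \<comment> \<open>The term of index 0 belongs to the integer 1, whose logarithm vanishes; it
    contributes exactly the 2 that turns \<open>2 * zeta x\<close> into
    \<open>2 * (zeta x - 1)\<close>.\<close>
  then have "(\<lambda>n. ?f (Suc n)) sums
      (x\<^sup>2 * zeta_deriv 2 x - 2 * x * zeta_deriv 1 x + 2 * zeta_deriv 0 x - ?f 0)"
    by (subst sums_Suc_iff) simp
  moreover have "?f 0 = 2"
    by (simp add: t_def)
  moreover have "(\<lambda>n. 49 / 8 * (1 / (real (n + 1) * real (n + 2) * real (n + 3)))) sums (49 / 8 * (1 / 4))"
    by (intro sums_mult sums_inverse_three_consecutive)
  moreover have "?f (Suc n) \<le> 49 / 8 * (1 / (real (n + 1) * real (n + 2) * real (n + 3)))" for n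
    using zeta_term_bound[OF assms, of n] by (simp add: t_def algebra_simps)
  ultimately have "x\<^sup>2 * zeta_deriv 2 x - 2 * x * zeta_deriv 1 x + 2 * zeta_deriv 0 x - 2 \<le> 49 / 8 * (1 / 4)"
    using sums_le by (metis (no_types, lifting))
  then show ?thesis
    by (simp add: zeta_deriv_0)
qed

section \<open>The contribution of \<open>ln_Gamma (x + 1)\<close> to the numerator\<close>

definition Gamma_part :: "real \<Rightarrow> real" where
  "Gamma_part x = x\<^sup>2 * Polygamma 1 (x + 1) - 2 * x * Digamma (x + 1) + 2 * ln_Gamma (x + 1)"

lemma Gamma_part_antimono:
  assumes "0 \<le> x" "x \<le> y"
  shows "Gamma_part y \<le> Gamma_part x"
proof (rule DERIV_nonpos_imp_nonincreasing[OF assms(2)])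
  fix z assume "x \<le> z" "z \<le> y"
  then have z: "z + 1 > 0"
    using assms by simp
  then have nz: "z + 1 \<notin> \<int>\<^sub>\<le>\<^sub>0"
    by (auto elim!: nonpos_Ints_cases)
  have "(Gamma_part has_field_derivative z\<^sup>2 * Polygamma 2 (z + 1)) (at z)"
    unfolding Gamma_part_def[abs_def] using z nz
    by (auto intro!: derivative_eq_intros simp: eval_nat_numeral algebra_simps)
  moreover have "z\<^sup>2 * Polygamma 2 (z + 1) \<le> 0"
    using Polygamma_real_even_neg[OF z, of 2] by (simp add: mult_nonneg_nonpos)
  ultimately show "\<exists>D. (Gamma_part has_field_derivative D) (at z) \<and> D \<le> 0"
    by blast
qed

text \<open>By the mean value theorem, the increment 1/x of \<open>Digamma\<close> over [x, x + 1]
  is a value of the decreasing function \<open>Polygamma 1\<close> inside that interval.\<close>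

lemma Polygamma_1_le_inverse:
  assumes "x > (0::real)"
  shows "Polygamma 1 (x + 1) \<le> 1 / x"
proof -
  have "\<exists>z. x < z \<and> z < x + 1 \<and> Digamma (x + 1) - Digamma x = (x + 1 - x) * Polygamma 1 z"
    using assms by (intro MVT2) (auto intro!: derivative_eq_intros elim!: nonpos_Ints_cases)
  then obtain z where z: "x < z" "z < x + 1" "Polygamma 1 z = 1 / x"
    using assms by (auto simp: Digamma_plus1)
  moreover have "Polygamma 1 (x + 1) < Polygamma 1 z"
    using z assms by (intro Polygamma_real_strict_antimono) auto
  ultimately show ?thesis
    by simp
qed

text \<open>At 7 the Digamma value is a harmonic number minus the Euler constant, and the Gamma
  value is 7!. The bounds add up to 7 - 14 (363/140 - 13/22) + 500/27, about -2.509, so there is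
  little slack.\<close>

lemma Gamma_part_7: "Gamma_part 7 + 2 * ln 2 \<le> - (5 / 2)"
proof -
  have "Digamma (8 :: real) = harm 7 - euler_mascheroni"
    using Digamma_of_nat[of 7, where 'a = real] by simp
  moreover have "harm 7 = (363 / 140 :: real)"
    by (simp add: harm_expand)
  moreover have "euler_mascheroni < (13 / 22 :: real)"
    by (rule euler_mascheroni_less_13_over_22)
  moreover have "Polygamma 1 (8 :: real) \<le> 1 / 7"
    using Polygamma_1_le_inverse[of 7] by simp
  moreover have "ln_Gamma (8 :: real) + ln 2 \<le> 250 / 27"
  proof -
    \<comment> \<open>Here 10080 = 2 * 7!, and its cube lies just below 2^40; hence the bound (40/3)
      (25/36) = 250/27.\<close>
    have "3 * (ln_Gamma (8 :: real) + ln 2) = ln (10080 ^ 3)"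
      using ln_Gamma_real_conv_fact[of 8] ln_mult[of 5040 2]
      by (subst ln_realpow) (auto simp: fact_numeral)
    also have "\<dots> \<le> ln (2 ^ 40)"
      by (subst ln_le_cancel_iff) auto
    also have "\<dots> = 40 * ln 2"
      by (subst ln_realpow) auto
    finally show ?thesis
      using ln2_le_25_over_36 by simp
  qed
  ultimately show ?thesis
    by (simp add: Gamma_part_def)
qed

section \<open>Second derivative of the logarithm and conclusion\<close>

lemma second_derivative_quotient:
  fixes L L1 :: "real \<Rightarrow> real"
  assumes "x \<noteq> 0" and "(L has_field_derivative L1 x) (at x)"
    and "(L1 has_field_derivative d) (at x)"
  shows "((\<lambda>x. L x / x) has_field_derivative (x * L1 x - L x) / x\<^sup>2) (at x)"
    and "((\<lambda>x. (x * L1 x - L x) / x\<^sup>2) has_field_derivative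
      (x\<^sup>2 * d - 2 * x * L1 x + 2 * L x) / x ^ 3) (at x)"
  using assms
  by (auto intro!: derivative_eq_intros simp: field_simps power2_eq_square power3_eq_cube)

theorem theorem3p3: "log_concave_on {7.1<..} theta"
proof -
  define L where "L x = ln 2 + ln (zeta x) + ln_Gamma (x + 1)" for x
  define L1 where "L1 x = zeta_deriv 1 x / zeta x + Digamma (x + 1)" for x
  define L2 where "L2 x = (zeta_deriv 2 x * zeta x - (zeta_deriv 1 x)\<^sup>2) / (zeta x)\<^sup>2
    + Polygamma 1 (x + 1)" for x
  have zeta_pos: "zeta x > 0" if "x > 1" for x
    using zeta_ge_1[OF that] by simp
  have base_pos: "2 * zeta x * Gamma (x + 1) > 0" if "x > 1" for x
    using zeta_pos[OF that] that by (intro mult_pos_pos Gamma_real_pos) auto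
  have ln_theta: "ln (theta x) = L x / x" if "x > 1" for x
    using zeta_pos[OF that] that less_imp_neq[OF Gamma_real_pos[of "x + 1"]]
    by (simp add: theta_def L_def ln_powr ln_mult ln_Gamma_real_pos)
  have L: "(L has_field_derivative L1 x) (at x)" if "x > 1" for x
    unfolding L_def[abs_def] L1_def
    using that zeta_pos[OF that] has_field_derivative_zeta_deriv[OF that, of 0]
    by (auto intro!: derivative_eq_intros simp: zeta_deriv_0)
  have L1: "(L1 has_field_derivative L2 x) (at x)" if "x > 1" for x
  proof -
    have "x + 1 \<notin> \<int>\<^sub>\<le>\<^sub>0"
      using that by (auto elim!: nonpos_Ints_cases)
    then show ?thesis
      unfolding L1_def[abs_def] L2_def
      using that zeta_pos[OF that] has_field_derivative_zeta_deriv[OF that, of 0]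
        has_field_derivative_zeta_deriv[OF that, of 1]
      by (auto intro!: derivative_eq_intros simp: zeta_deriv_0 power2_eq_square numeral_2_eq_2)
  qed
  have numerator: "x\<^sup>2 * L2 x - 2 * x * L1 x + 2 * L x \<le> 0" if "x > 7" for x
  proof -
    have z: "zeta x \<ge> 1"
      using zeta_ge_1 that by simp
    have d1: "zeta_deriv 1 x \<le> 0"
      using that summable_zeta_deriv[of x 1] unfolding zeta_deriv_def
      by (intro suminf_le_const sum_nonpos) (auto simp: mult_nonpos_nonneg)
    have d2: "zeta_deriv 2 x \<ge> 0"
      using that summable_zeta_deriv[of x 2] unfolding zeta_deriv_def
      by (intro suminf_nonneg) auto
    \<comment> \<open>The square of the first derivative is dropped, and division by
      \<open>zeta x\<close> \<ge> 1 can only decrease the nonnegative second derivative.\<close>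
    have "(zeta_deriv 2 x * zeta x - (zeta_deriv 1 x)\<^sup>2) / (zeta x)\<^sup>2
        \<le> zeta_deriv 2 x * zeta x / (zeta x)\<^sup>2"
      using z by (intro divide_right_mono) auto
    also have "\<dots> = zeta_deriv 2 x / zeta x"
      using z by (simp add: power2_eq_square)
    also have "\<dots> \<le> zeta_deriv 2 x"
      using z d2 by (simp add: divide_le_eq mult_le_cancel_left1)
    finally have "x\<^sup>2 * L2 x \<le> x\<^sup>2 * (zeta_deriv 2 x + Polygamma 1 (x + 1))"
      by (intro mult_left_mono) (auto simp: L2_def)
    \<comment> \<open>The first derivative is nonpositive, so division by \<open>zeta x\<close>
      \<ge> 1 moves it up towards 0.\<close>
    moreover have "zeta_deriv 1 x \<le> zeta_deriv 1 x / zeta x"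
      using z d1 by (simp add: le_divide_eq mult_le_cancel_left2)
    then have "2 * x * (zeta_deriv 1 x + Digamma (x + 1)) \<le> 2 * x * L1 x"
      using that by (intro mult_left_mono) (auto simp: L1_def)
    moreover have "ln (zeta x) \<le> zeta x - 1"
      using z by (intro ln_le_minus_one) auto
    moreover have "Gamma_part x \<le> Gamma_part 7"
      using that by (intro Gamma_part_antimono) auto
    ultimately show ?thesis
      \<comment> \<open>The numerator is now at most 49/32 - 5/2 < 0.\<close>
      using zeta_part_bound[of x] Gamma_part_7 that
      by (simp add: L_def Gamma_part_def algebra_simps)
  qed
  have "concave_on {7.1<..} (\<lambda>x. ln (theta x))"
  proof (rule f''_le0_imp_concave)
    fix x :: real assume "x \<in> {7.1<..}"
    then have x: "x > 7" "x > 1" "x \<noteq> 0"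
      by auto
    have "((\<lambda>x. L x / x) has_field_derivative (x * L1 x - L x) / x\<^sup>2) (at x)"
      by (rule second_derivative_quotient(1)[OF x(3) L[OF x(2)] L1[OF x(2)]])
    \<comment> \<open>The formula for \<open>ln (theta x)\<close> is available only for x > 1, so
      the derivative is transferred on that open set.\<close>
    then show "((\<lambda>x. ln (theta x)) has_field_derivative (x * L1 x - L x) / x\<^sup>2) (at x)"
      by (rule has_field_derivative_transform_within_open[of _ _ _ "{1<..}"])
        (use x in \<open>auto simp: ln_theta\<close>)
    show "((\<lambda>x. (x * L1 x - L x) / x\<^sup>2) has_field_derivative
        (x\<^sup>2 * L2 x - 2 * x * L1 x + 2 * L x) / x ^ 3) (at x)"
      by (rule second_derivative_quotient(2)[OF x(3) L[OF x(2)] L1[OF x(2)]])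
    show "(x\<^sup>2 * L2 x - 2 * x * L1 x + 2 * L x) / x ^ 3 \<le> 0"
      using numerator[OF x(1)] x by (intro divide_nonpos_nonneg) auto
  qed simp
  moreover have "theta x > 0" if "x > 7.1" for x
    using base_pos[of x] that by (auto simp: theta_def)
  ultimately show ?thesis
    by (auto simp: log_concave_on_def)
qed

end
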